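(* For each $Z=\begin{pmatrix}\alpha&\beta\\0&0\end{pmatrix}$ with $\alpha,\beta\in\mathbb R$, and each compactly supported function $u\in C_0^\infty(\mathbb R^2)$ of variables $(x,q)$, $$\hat\ell_Z(u):=\mathcal F_p\circ\ell_Z\circ\mathcal F_p^{-1}(u)=\alpha\left(\tfrac12\partial_q-\partial_x\right)u+i\beta e^{q-\frac x2}u,$$ where $\ell_Z(v)=i\tilde Z\star v$ is left Moyal $\star$-multiplication by $i\tilde Z$, with $\tilde Z(p,q)=\alpha p+\beta e^q$.
   Context: $\mathfrak g=\mathrm{aff}(\mathbb R)$ is the Lie algebra of matrices $Z=\begin{pmatrix}\alpha&\beta\\0&0\end{pmatrix}$. In the canonical coordinates $(p,q)\in\mathbb R^2$ on the co-adjoint orbit $\Omega_+$ (the point with coordinates $(p,q)$ being $pX^*+e^qY^*$), the linear function $F\mapsto\langle F,Z\rangle$ is $\tilde Z(p,q)=\alpha p+\beta e^q$. Moyal product on $\mathbb R^2$ with coordinates $(x^1,x^2)=(p,q)$: $$u\star v=uv+\sum_{r\ge1}\frac1{r!}\left(\frac1{2i}\right)^rP^r(u,v),$$ $$P^r(u,v)=\sum_{i_1,j_1,\dots,i_r,j_r\in\{1,2\}}\Lambda^{i_1j_1}\cdots\Lambda^{i_rj_r}\,\frac{\partial^r u}{\partial x^{i_1}\cdots\partial x^{i_r}}\,\frac{\partial^r v}{\partial x^{j_1}\cdots\partial x^{j_r}},$$ with $\Lambda^{12}=1$, $\Lambda^{21}=-1$, $\Lambda^{11}=\Lambda^{22}=0$,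 so that $P^1(u,v)=\{u,v\}=\partial_pu\,\partial_qv-\partial_qu\,\partial_pv$. The series defining $i\tilde Z\star\mathcal F_p^{-1}(u)$ is understood as a convergent series of functions. Partial Fourier transforms: $\mathcal F_p(v)(x,q)=\frac1{\sqrt{2\pi}}\int_{\mathbb R}e^{-ipx}v(p,q)\,dp$ and $\mathcal F_p^{-1}(u)(p,q)=\frac1{\sqrt{2\pi}}\int_{\mathbb R}e^{ipx}u(x,q)\,dx$. *)

theory Defs
  imports "HOL-Analysis.Analysis"
begin

text \<open>Points of the plane are elements of \<open>real ^ 2\<close>; the first component is \<open>p\<close> (or its Fourier
  dual variable \<open>x\<close>) and the second one is \<open>q\<close>.\<close>

section \<open>Partial derivatives and test functions\<close>

definition partial :: "2 \<Rightarrow> (real ^ 2 \<Rightarrow> complex) \<Rightarrow> real ^ 2 \<Rightarrow> complex" where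
  "partial i f x = vector_derivative (\<lambda>t. f (x + t *\<^sub>R axis i 1)) (at 0)"

text \<open>\<open>partials [i\<^sub>1, \<dots>, i\<^sub>r] f\<close> is \<open>\<partial>\<^sup>r f / \<partial>x\<^bsup>i\<^sub>1\<^esup> \<dots> \<partial>x\<^bsup>i\<^sub>r\<^esup>\<close>.\<close>

definition partials :: "2 list \<Rightarrow> (real ^ 2 \<Rightarrow> complex) \<Rightarrow> real ^ 2 \<Rightarrow> complex" where
  "partials is f = foldr partial is f"

text \<open>Since \<^const>\<open>vector_derivative\<close> is total, the existence of each partial derivative is required
  separately from its continuity.\<close>

definition smooth :: "(real ^ 2 \<Rightarrow> complex) \<Rightarrow> bool" where
  "smooth f \<longleftrightarrow>
    (\<forall>is. continuous_on UNIV (partials is f) \<and>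
      (\<forall>i x. (\<lambda>t. partials is f (x + t *\<^sub>R axis i 1)) differentiable (at 0)))"

definition test_function :: "(real ^ 2 \<Rightarrow> complex) \<Rightarrow> bool" where
  "test_function u \<longleftrightarrow> smooth u \<and> compact (closure {x. u x \<noteq> 0})"

section \<open>Moyal product\<close>

definition Lambda :: "2 \<Rightarrow> 2 \<Rightarrow> complex" where
  "Lambda i j = (if i = 1 \<and> j = 2 then 1 else if i = 2 \<and> j = 1 then -1 else 0)"

text \<open>The multi-index \<open>(i\<^sub>1, j\<^sub>1, \<dots>, i\<^sub>r, j\<^sub>r)\<close> is encoded as the list of the pairs \<open>(i\<^sub>k, j\<^sub>k)\<close>.\<close>

definition moyal_P ::
    "nat \<Rightarrow> (real ^ 2 \<Rightarrow> complex) \<Rightarrow> (real ^ 2 \<Rightarrow> complex) \<Rightarrow> real ^ 2 \<Rightarrow> complex" where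
  "moyal_P r u v x =
    (\<Sum>ks | length ks = r.
      (\<Prod>(i, j)\<leftarrow>ks. Lambda i j) * partials (map fst ks) u x * partials (map snd ks) v x)"

definition moyal_term ::
    "(real ^ 2 \<Rightarrow> complex) \<Rightarrow> (real ^ 2 \<Rightarrow> complex) \<Rightarrow> real ^ 2 \<Rightarrow> nat \<Rightarrow> complex" where
  "moyal_term u v x r = 1 / fact r * (1 / (2 * \<i>)) ^ r * moyal_P r u v x"

text \<open>The sum over \<open>r \<ge> 1\<close> is indexed by \<open>Suc r\<close>. It is the pointwise sum, and meaningful only
  where the series is summable.\<close>

definition moyal ::
    "(real ^ 2 \<Rightarrow> complex) \<Rightarrow> (real ^ 2 \<Rightarrow> complex) \<Rightarrow> real ^ 2 \<Rightarrow> complex" where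
  "moyal u v x = u x * v x + (\<Sum>r. moyal_term u v x (Suc r))"

section \<open>Partial Fourier transforms\<close>

definition Fp :: "(real ^ 2 \<Rightarrow> complex) \<Rightarrow> real ^ 2 \<Rightarrow> complex" where
  "Fp v y = 1 / sqrt (2 * pi) *
     (LINT p|lborel. exp (- (\<i> * complex_of_real p * complex_of_real (y $ 1))) * v (vector [p, y $ 2]))"

definition Fp_inv :: "(real ^ 2 \<Rightarrow> complex) \<Rightarrow> real ^ 2 \<Rightarrow> complex" where
  "Fp_inv u y = 1 / sqrt (2 * pi) *
     (LINT x|lborel. exp (\<i> * complex_of_real (y $ 1) * complex_of_real x) * u (vector [x, y $ 2]))"

section \<open>The Lie algebra and the operators\<close>

definition aff_matrix :: "real \<Rightarrow> real \<Rightarrow> real ^ 2 ^ 2" where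
  "aff_matrix \<alpha> \<beta> = vector [vector [\<alpha>, \<beta>], vector [0, 0]]"

text \<open>\<open>X\<^sup>*\<close> and \<open>Y\<^sup>*\<close> are dual to the basis \<open>X = aff_matrix 1 0\<close>, \<open>Y = aff_matrix 0 1\<close>.\<close>

definition X_star :: "real ^ 2 ^ 2 \<Rightarrow> real" where
  "X_star Z = Z $ 1 $ 1"

definition Y_star :: "real ^ 2 ^ 2 \<Rightarrow> real" where
  "Y_star Z = Z $ 1 $ 2"

text \<open>The functional \<open>p X\<^sup>* + e\<^sup>q Y\<^sup>*\<close>, i.e. the point of the orbit with canonical coordinates
  \<open>(p, q)\<close>.\<close>

definition orbit_point :: "real ^ 2 \<Rightarrow> real ^ 2 ^ 2 \<Rightarrow> real" where
  "orbit_point y Z = y $ 1 * X_star Z + exp (y $ 2) * Y_star Z"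

definition tilde :: "real ^ 2 ^ 2 \<Rightarrow> real ^ 2 \<Rightarrow> real" where
  "tilde Z y = orbit_point y Z"

lemma tilde_aff_matrix: "tilde (aff_matrix \<alpha> \<beta>) y = \<alpha> * y $ 1 + \<beta> * exp (y $ 2)"
  by (simp add: tilde_def orbit_point_def X_star_def Y_star_def aff_matrix_def)

definition i_tilde :: "real ^ 2 ^ 2 \<Rightarrow> real ^ 2 \<Rightarrow> complex" where
  "i_tilde Z y = \<i> * complex_of_real (tilde Z y)"

definition ell :: "real ^ 2 ^ 2 \<Rightarrow> (real ^ 2 \<Rightarrow> complex) \<Rightarrow> real ^ 2 \<Rightarrow> complex" where
  "ell Z v = moyal (i_tilde Z) v"

definition ell_hat :: "real ^ 2 ^ 2 \<Rightarrow> (real ^ 2 \<Rightarrow> complex) \<Rightarrow> real ^ 2 \<Rightarrow> complex" where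
  "ell_hat Z = Fp \<circ> ell Z \<circ> Fp_inv"

end

theory Submission
  imports Defs "HOL-Probability.Probability"
begin

text \<open>Under the inverse transform, multiplication by \<open>i x\<close> becomes \<open>\<partial>\<^sub>p\<close> and \<open>\<partial>\<^sub>x\<close> becomes multiplication
  by \<open>- i p\<close>. In the Moyal series of \<open>\<alpha> p + \<beta> e\<^sup>q\<close> the first summand contributes only up to order
  one, and the second one contributes \<open>\<beta> e\<^sup>q (i/2)\<^sup>n \<partial>\<^sub>p\<^sup>n / n!\<close> at each order \<open>n\<close>, that is, the terms of
  the exponential series of \<open>e\<^bsup>q - x/2\<^esup>\<close> on the Fourier side. Hence left multiplication of
  the inverse transform of \<open>u\<close> is the inverse transform of the claimed test function, and Fourier inversion
  concludes.\<close>

section \<open>Smooth functions and test functions\<close>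

text \<open>Relational form of \<open>partial\<close>: it records existence together with the value,
  which the total function \<open>partial\<close> cannot express, so that calculus rules
  compose.\<close>

definition has_partial :: "2 \<Rightarrow> (real ^ 2 \<Rightarrow> complex) \<Rightarrow> (real ^ 2 \<Rightarrow> complex) \<Rightarrow> bool" where
  "has_partial i f f' \<longleftrightarrow>
    (\<forall>x. ((\<lambda>t. f (x + t *\<^sub>R axis i 1)) has_vector_derivative f' x) (at 0))"

lemma partial_eqI: "has_partial i f f' \<Longrightarrow> partial i f = f'"
  by (auto simp: has_partial_def partial_def fun_eq_iff intro!: vector_derivative_at)

text \<open>Moving the base point along the line and shifting the parameter transports the
  derivative at 0 to any parameter \<open>s\<close>.\<close>

lemma has_partial_along:
  assumes "has_partial i f f'"
  shows "((\<lambda>t. f (x + t *\<^sub>R axis i 1)) has_vector_derivative f' (x + s *\<^sub>R axis i 1)) (at s)"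
proof -
  have "((\<lambda>t. t - s) has_vector_derivative 1) (at s)"
    by (auto intro!: derivative_eq_intros)
  moreover have "((\<lambda>t. f ((x + s *\<^sub>R axis i 1) + t *\<^sub>R axis i 1)) has_vector_derivative
      f' (x + s *\<^sub>R axis i 1)) (at (s - s))"
    using assms by (simp add: has_partial_def)
  ultimately have "((\<lambda>t. f ((x + s *\<^sub>R axis i 1) + t *\<^sub>R axis i 1)) \<circ> (\<lambda>t. t - s)
      has_vector_derivative 1 *\<^sub>R f' (x + s *\<^sub>R axis i 1)) (at s)"
    by (rule vector_diff_chain_at)
  then show ?thesis
    by (simp add: o_def algebra_simps)
qed

lemma has_partial_const [intro]: "has_partial i (\<lambda>_. c) (\<lambda>_. 0)"
  by (simp add: has_partial_def)

lemma has_partial_add: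
  "has_partial i f f' \<Longrightarrow> has_partial i g g' \<Longrightarrow> has_partial i (\<lambda>x. f x + g x) (\<lambda>x. f' x + g' x)"
  by (auto simp: has_partial_def intro!: derivative_intros)

lemma has_partial_mult:
  "has_partial i f f' \<Longrightarrow> has_partial i g g' \<Longrightarrow>
    has_partial i (\<lambda>x. f x * g x) (\<lambda>x. f x * g' x + f' x * g x)"
  unfolding has_partial_def
  by (intro allI, rule has_vector_derivative_eq_rhs, rule has_vector_derivative_mult) auto

lemma axis_component_2:
  "(axis 1 a :: real ^ 2) $ 1 = a" "(axis 1 a :: real ^ 2) $ 2 = 0"
  "(axis 2 a :: real ^ 2) $ 1 = 0" "(axis 2 a :: real ^ 2) $ 2 = a"
  by (simp_all add: axis_def)

lemma has_partial_comp_2: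
  assumes "\<And>x. (h has_field_derivative h' x) (at x)"
  shows "has_partial i (\<lambda>y. h (complex_of_real (y $ j))) (\<lambda>y. of_bool (i = j) * h' (complex_of_real (y $ j)))"
  unfolding has_partial_def
proof
  fix x :: "real ^ 2"
  have "((\<lambda>t. complex_of_real ((x + t *\<^sub>R axis i 1) $ j)) has_vector_derivative of_bool (i = j)) (at 0)"
    by (cases "i = j") (auto simp: axis_def intro!: derivative_eq_intros)
  from field_vector_diff_chain_at[OF this, of h "h' (complex_of_real (x $ j))"] assms
  show "((\<lambda>t. h (complex_of_real ((x + t *\<^sub>R axis i 1) $ j))) has_vector_derivative
      of_bool (i = j) * h' (complex_of_real (x $ j))) (at 0)"
    by (simp add: o_def)
qed

text \<open>By induction on the list, every iterated partial derivative stays in \<open>P\<close>.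
  Smoothness thus reduces to exhibiting a class of continuous functions closed under
  differentiation, without formulas for higher derivatives.\<close>

lemma smooth_coinduct:
  assumes "P f"
    and cont: "\<And>f. P f \<Longrightarrow> continuous_on UNIV f"
    and step: "\<And>f i. P f \<Longrightarrow> \<exists>f'. has_partial i f f' \<and> P f'"
  shows "smooth f"
proof -
  have P: "P (partials is f)" for "is"
  proof (induction "is")
    case Nil
    then show ?case
      using \<open>P f\<close> by (simp add: partials_def)
  next
    case (Cons i "is")
    then show ?case
      using step[of "partials is f" i] partial_eqI by (auto simp: partials_def)
  qed
  show ?thesis
    unfolding smooth_def
  proof (intro allI conjI)
    fix "is" i x
    show "continuous_on UNIV (partials is f)"
      by (rule cont[OF P])
    obtain f' where "has_partial i (partials is f) f'"
      using step[OF P] by blast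
    then show "(\<lambda>t. partials is f (x + t *\<^sub>R axis i 1)) differentiable (at 0)"
      unfolding has_partial_def using differentiableI_vector by blast
  qed
qed

section \<open>Closure properties of smooth functions\<close>

lemma smooth_imp_continuous: "smooth f \<Longrightarrow> continuous_on UNIV f"
  unfolding smooth_def by (drule spec[of _ "[]"]) (simp add: partials_def)

lemma smooth_has_partial: "smooth f \<Longrightarrow> has_partial i f (partial i f)"
  unfolding smooth_def has_partial_def partial_def vector_derivative_works[symmetric]
  by (drule spec[of _ "[]"]) (simp add: partials_def)

lemma smooth_partial: "smooth f \<Longrightarrow> smooth (partial i f)"
proof -
  have "partials is (partial i f) = partials (is @ [i]) f" for "is"
    by (simp add: partials_def)
  then show "smooth f \<Longrightarrow> smooth (partial i f)"
    by (simp add: smooth_def)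
qed

text \<open>The Leibniz rule turns one product into a sum of two, so single products are not a
  suitable class for \<open>smooth_coinduct\<close>; their finite sums are.\<close>

inductive sum_of_products :: "(real ^ 2 \<Rightarrow> complex) \<Rightarrow> bool" where
  mult: "smooth f \<Longrightarrow> smooth g \<Longrightarrow> sum_of_products (\<lambda>x. f x * g x)"
| add: "sum_of_products f \<Longrightarrow> sum_of_products g \<Longrightarrow> sum_of_products (\<lambda>x. f x + g x)"

lemma sum_of_products_smooth: "sum_of_products f \<Longrightarrow> smooth f"
proof (rule smooth_coinduct[of sum_of_products], assumption)
  show "continuous_on UNIV f" if "sum_of_products f" for f
    using that by induction (auto intro: continuous_on_mult continuous_on_add dest: smooth_imp_continuous)
  show "\<exists>f'. has_partial i f f' \<and> sum_of_products f'" if "sum_of_products f" for f i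
    using that
  proof induction
    case (mult f g)
    then have "has_partial i (\<lambda>x. f x * g x) (\<lambda>x. f x * partial i g x + partial i f x * g x)"
      by (intro has_partial_mult smooth_has_partial)
    moreover have "sum_of_products (\<lambda>x. f x * partial i g x + partial i f x * g x)"
      by (intro sum_of_products.intros smooth_partial mult)
    ultimately show ?case
      by blast
  next
    case (add f g)
    then obtain f' g' where "has_partial i f f'" "has_partial i g g'"
        "sum_of_products f'" "sum_of_products g'"
      by blast
    then show ?case
      using has_partial_add sum_of_products.add by blast
  qed
qed

lemma smooth_mult: "smooth f \<Longrightarrow> smooth g \<Longrightarrow> smooth (\<lambda>x. f x * g x)"
  by (rule sum_of_products_smooth) (rule sum_of_products.mult)

lemma smooth_const: "smooth (\<lambda>_. c)"
  by (rule smooth_coinduct[of "\<lambda>f. \<exists>c. f = (\<lambda>_. c)"]) (auto intro!: exI has_partial_const)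

lemma smooth_add:
  assumes "smooth f" "smooth g"
  shows "smooth (\<lambda>x. f x + g x)"
proof -
  \<comment> \<open>The constant factor 1 makes each summand a product of smooth functions.\<close>
  have "sum_of_products (\<lambda>x. f x * 1 + g x * 1)"
    by (intro sum_of_products.intros assms smooth_const)
  then show ?thesis
    by (simp add: sum_of_products_smooth)
qed

lemma has_partial_component: "has_partial i (\<lambda>y. complex_of_real (y $ j)) (\<lambda>_. of_bool (i = j))"
  using has_partial_comp_2[of "\<lambda>z. z" "\<lambda>_. 1"] by simp

lemma smooth_component: "smooth (\<lambda>y. complex_of_real (y $ j))"
proof (rule smooth_coinduct[of "\<lambda>f. f = (\<lambda>y. complex_of_real (y $ j)) \<or> (\<exists>c. f = (\<lambda>_. c))"])
  show "continuous_on UNIV f"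
    if "f = (\<lambda>y. complex_of_real (y $ j)) \<or> (\<exists>c. f = (\<lambda>_. c))" for f
    using that by (auto intro!: continuous_intros)
qed (use has_partial_component in blast)+

text \<open>The free factor \<open>c\<close> in the class makes it closed: differentiation in
  direction \<open>j\<close> multiplies \<open>c\<close> by \<open>a\<close>, and in the other
  direction replaces it by 0.\<close>

lemma smooth_exp_component: "smooth (\<lambda>y. exp (a * complex_of_real (y $ j)))"
proof (rule smooth_coinduct[of "\<lambda>f. \<exists>c. f = (\<lambda>y. c * exp (a * complex_of_real (y $ j)))"])
  show "\<exists>c. (\<lambda>y. exp (a * complex_of_real (y $ j))) = (\<lambda>y. c * exp (a * complex_of_real (y $ j)))"
    by (rule exI[of _ 1]) simp
  show "continuous_on UNIV f" if "\<exists>c. f = (\<lambda>y. c * exp (a * complex_of_real (y $ j)))" for f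
    using that by (auto intro!: continuous_intros)
  fix f i
  assume "\<exists>c. f = (\<lambda>y. c * exp (a * complex_of_real (y $ j)))"
  then obtain c where f: "f = (\<lambda>y. c * exp (a * complex_of_real (y $ j)))"
    by blast
  have "has_partial i f (\<lambda>y. of_bool (i = j) * (c * a * exp (a * complex_of_real (y $ j))))"
    unfolding f by (rule has_partial_comp_2) (auto intro!: derivative_eq_intros)
  then show "\<exists>f'. has_partial i f f' \<and> (\<exists>c. f' = (\<lambda>y. c * exp (a * complex_of_real (y $ j))))"
    by (intro exI[of _ "\<lambda>y. of_bool (i = j) * (c * a * exp (a * complex_of_real (y $ j)))"]
        conjI exI[of _ "of_bool (i = j) * (c * a)"]) (auto simp: mult_ac)
qed

lemma smooth_power: "smooth f \<Longrightarrow> smooth (\<lambda>y. f y ^ n)"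
  by (induction n) (simp_all add: smooth_const smooth_mult)

section \<open>Stability of test functions under multiplication, differentiation and
  addition\<close>

lemma test_function_smooth: "test_function u \<Longrightarrow> smooth u"
  by (simp add: test_function_def)

text \<open>A closed subset of a compact set is compact. The inclusion is into the closure because a
  derivative of \<open>u\<close> may be nonzero at a point where \<open>u\<close> vanishes.\<close>

lemma test_function_if_support:
  assumes "test_function u" "smooth v" "{x. v x \<noteq> 0} \<subseteq> closure {x. u x \<noteq> 0}"
  shows "test_function v"
  using assms compact_Int_closed[of "closure {x. u x \<noteq> 0}" "closure {x. v x \<noteq> 0}"]
    closure_minimal[OF assms(3)]
  by (simp add: test_function_def inf.absorb2)

lemma test_function_mult:
  assumes "test_function u" "smooth f"
  shows "test_function (\<lambda>y. f y * u y)"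
proof (rule test_function_if_support[OF assms(1)])
  show "smooth (\<lambda>y. f y * u y)"
    using assms by (simp add: smooth_mult test_function_smooth)
  have "{x. f x * u x \<noteq> 0} \<subseteq> {x. u x \<noteq> 0}"
    by auto
  then show "{x. f x * u x \<noteq> 0} \<subseteq> closure {x. u x \<noteq> 0}"
    using closure_subset by (rule subset_trans)
qed

text \<open>The complement of the closed support is open, so near a point outside it
  \<open>u\<close> is zero along the coordinate line and the derivative there is 0.\<close>

lemma test_function_partial:
  assumes "test_function u"
  shows "test_function (partial i u)"
proof (rule test_function_if_support[OF assms])
  show "smooth (partial i u)"
    using assms by (simp add: smooth_partial test_function_smooth)
  show "{x. partial i u x \<noteq> 0} \<subseteq> closure {x. u x \<noteq> 0}"
  proof (rule ccontr)
    let ?K = "closure {x. u x \<noteq> 0}"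
    assume "\<not> {x. partial i u x \<noteq> 0} \<subseteq> ?K"
    then obtain x where x: "partial i u x \<noteq> 0" "x \<notin> ?K"
      by blast
    let ?S = "(\<lambda>t. x + t *\<^sub>R axis i 1) -` (- ?K)"
    have "((\<lambda>t. u (x + t *\<^sub>R axis i 1)) has_vector_derivative 0) (at 0)"
    proof (rule has_vector_derivative_transform_within_open[OF has_vector_derivative_const])
      show "open ?S"
        by (intro open_vimage continuous_intros) simp
      show "0 \<in> ?S"
        using x by simp
      show "0 = u (x + t *\<^sub>R axis i 1)" if "t \<in> ?S" for t
        using that closure_subset[of "{x. u x \<noteq> 0}"] by auto
    qed
    then have "partial i u x = 0"
      unfolding partial_def by (rule vector_derivative_at)
    with x show False by simp
  qed
qed

lemma test_function_add:
  assumes "test_function u" "test_function v"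
  shows "test_function (\<lambda>y. u y + v y)"
proof -
  have "closure {x. u x + v x \<noteq> 0} \<subseteq> closure {x. u x \<noteq> 0} \<union> closure {x. v x \<noteq> 0}"
    by (subst closure_Un[symmetric]) (rule closure_mono, auto)
  then show ?thesis
    using assms compact_Un[of "closure {x. u x \<noteq> 0}" "closure {x. v x \<noteq> 0}"]
      compact_Int_closed[of "closure {x. u x \<noteq> 0} \<union> closure {x. v x \<noteq> 0}"
        "closure {x. u x + v x \<noteq> 0}"]
    by (simp add: test_function_def smooth_add inf.absorb2)
qed

section \<open>Test functions on horizontal lines\<close>

lemma continuous_on_vector_2:
  assumes "continuous_on S f" "continuous_on S g"
  shows "continuous_on S (\<lambda>x. vector [f x, g x] :: real ^ 2)"
proof -
  have eq: "(\<lambda>x. vector [f x, g x] :: real ^ 2) = (\<lambda>x. \<chi> i. if i = 1 then f x else g x)"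
    by (auto simp: fun_eq_iff vec_eq_iff forall_2)
  have "continuous_on S (\<lambda>x. if i = 1 then f x else g x)" for i :: 2
    using assms by (cases "i = 1") simp_all
  then show ?thesis
    unfolding eq by (rule continuous_on_vec_lambda)
qed

text \<open>The support is bounded in the plane, so one \<open>R\<close> serves all
  \<open>q\<close>. Integrals over lines then have a common compact domain, as differentiation under
  the integral sign requires.\<close>

lemma test_function_vanishes:
  assumes "test_function u"
  obtains R where "R > 0" "\<And>x q. \<bar>x\<bar> \<ge> R \<Longrightarrow> u (vector [x, q]) = 0"
proof -
  have "bounded {x. u x \<noteq> 0}"
    using assms by (intro bounded_subset[OF compact_imp_bounded closure_subset])
      (simp add: test_function_def)
  then obtain R where R: "\<And>x. u x \<noteq> 0 \<Longrightarrow> norm x < R" "R > 0"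
    unfolding bounded_pos_less by blast
  have "u (vector [x, q]) = 0" if "\<bar>x\<bar> \<ge> R" for x q
    using R(1)[of "vector [x, q]"] component_le_norm_cart[of "vector [x, q] :: real ^ 2" 1] that
    by (auto simp: )
  with R(2) that show ?thesis by blast
qed

text \<open>Bridge from the Lebesgue integral in the transforms to the integral over a compact
  interval, where the Leibniz rule and the fundamental theorem of calculus are applied.\<close>

lemma
  fixes f :: "real \<Rightarrow> complex"
  assumes "continuous_on UNIV f" "\<And>x. \<bar>x\<bar> \<ge> R \<Longrightarrow> f x = 0"
  shows integrable_lborel_vanishing: "integrable lborel f"
    and integral_lborel_vanishing: "(LINT x|lborel. f x) = integral {-R..R} f"
proof -
  have eq: "(\<lambda>x. indicator {-R..R} x *\<^sub>R f x) = f"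
    using assms(2) by (auto simp: fun_eq_iff indicator_def)
  have "continuous_on {-R..R} f"
    using assms(1) continuous_on_subset by blast
  from borel_integrable_atLeastAtMost'[OF this] show *: "integrable lborel f"
    unfolding set_integrable_def eq .
  have "(\<lambda>x. if x \<in> {-R..R} then f x else 0) = f"
    using assms(2) by (auto simp: fun_eq_iff)
  then have "integral {-R..R} f = integral UNIV f"
    by (metis integral_restrict_UNIV)
  with integral_lborel[OF *] show "(LINT x|lborel. f x) = integral {-R..R} f"
    by simp
qed

section \<open>Fourier inversion on the line\<close>

text \<open>This is the characteristic function of the standard normal distribution, with the
  normalising constant of the density moved to the other side.\<close>

lemma integral_gaussian_character:
  "(LINT s|lborel. exp (\<i> * complex_of_real (s * t)) * complex_of_real (exp (- s\<^sup>2 / 2))) =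
    complex_of_real (sqrt (2 * pi) * exp (- t\<^sup>2 / 2))"
proof -
  have "complex_of_real (exp (- t\<^sup>2 / 2)) = (LINT s|std_normal_distribution. exp (\<i> * complex_of_real (t * s)))"
    using fun_cong[OF char_std_normal_distribution, of t] by (simp add: char_def)
  also have "\<dots> = (LINT s|lborel. std_normal_density s *\<^sub>R exp (\<i> * complex_of_real (t * s)))"
    by (rule integral_density) auto
  also have "\<dots> = complex_of_real (1 / sqrt (2 * pi)) *
      (LINT s|lborel. exp (\<i> * complex_of_real (s * t)) * complex_of_real (exp (- s\<^sup>2 / 2)))"
    by (subst integral_mult_right_zero[symmetric], rule Bochner_Integration.integral_cong)
       (auto simp: std_normal_density_def scaleR_conv_of_real mult_ac)
  finally show ?thesis
    by (simp add: field_simps)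
qed

lemma integrable_gaussian:
  fixes \<sigma> :: real
  assumes "\<sigma> \<noteq> 0"
  shows "integrable lborel (\<lambda>s. exp (- (\<sigma> * s)\<^sup>2 / 2))"
proof -
  have "integrable lborel (\<lambda>s. sqrt (2 * pi) * std_normal_density s)"
    by (intro integrable_mult_right integrable_normal_density) auto
  then have "integrable lborel (\<lambda>s. exp (- s\<^sup>2 / 2) :: real)"
    by (simp add: std_normal_density_def)
  from lborel_integrable_real_affine[OF this assms, of 0] show ?thesis
    by simp
qed

lemma integral_gaussian:
  "(LINT s|lborel. complex_of_real (exp (- s\<^sup>2 / 2))) = complex_of_real (sqrt (2 * pi))"
  using integral_gaussian_character[of 0] by simp

lemma integrable_bounded_mult:
  fixes f g :: "'a \<Rightarrow> complex"
  assumes "integrable M f" "g \<in> borel_measurable M" "\<And>x. norm (g x) \<le> C"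
  shows "integrable M (\<lambda>x. g x * f x)"
proof (rule Bochner_Integration.integrable_bound)
  show "integrable M (\<lambda>x. complex_of_real C * f x)"
    using assms(1) by simp
  have "norm (g x * f x) \<le> norm (complex_of_real C * f x)" for x
    using assms(3)[of x] norm_ge_zero[of "g x"]
    by (auto simp: norm_mult intro!: mult_right_mono)
  then show "AE x in M. norm (g x * f x) \<le> norm (complex_of_real C * f x)"
    by simp
qed (use assms in simp)

text \<open>The Gaussian factor makes the double integral absolutely convergent. After exchanging
  the order, the integral over \<open>p\<close> is again a Gaussian, of width \<sigma> around
  \<open>y\<close>, and rescaling gives a weighted mean of \<open>f\<close> near
  \<open>y\<close>.\<close>

lemma gaussian_mean_integral:
  fixes f :: "real \<Rightarrow> complex" and \<sigma> y :: real
  assumes f: "integrable lborel f" and "\<sigma> > 0"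
  shows "(LINT p|lborel. exp (- (\<i> * complex_of_real (p * y))) *
      (LINT x|lborel. exp (\<i> * complex_of_real (p * x)) * f x) * complex_of_real (exp (- (\<sigma> * p)\<^sup>2 / 2)))
    = complex_of_real (sqrt (2 * pi)) *
      (LINT z|lborel. f (y + \<sigma> * z) * complex_of_real (exp (- z\<^sup>2 / 2)))"
proof -
  define G where "G p = complex_of_real (exp (- (\<sigma> * p)\<^sup>2 / 2))" for p
  define e where "e p x = exp (\<i> * complex_of_real (p * (x - y)))" for p x
  have [measurable]: "f \<in> borel_measurable borel"
    using f by (simp add: borel_measurable_integrable)
  have [measurable]: "G \<in> borel_measurable borel"
    "(\<lambda>z. e (fst z) (snd z)) \<in> borel_measurable (borel \<Otimes>\<^sub>M borel)"
    unfolding G_def e_def by measurable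
  have G: "integrable lborel G"
    unfolding G_def using integrable_gaussian[of \<sigma>] \<open>\<sigma> > 0\<close> by simp
  \<comment> \<open>Since \<open>e p x\<close> has modulus 1, the integrand has modulus
    \<open>norm (G p) * norm (f x)\<close>, a product of integrable functions.\<close>
  have int: "integrable (lborel \<Otimes>\<^sub>M lborel) (\<lambda>(p, x). e p x * (G p * f x))"
  proof (rule lborel_pair.Fubini_integrable)
    show "(\<lambda>(p, x). e p x * (G p * f x)) \<in> borel_measurable (lborel \<Otimes>\<^sub>M lborel)"
      by (simp add: split_beta)
    have "(LINT x|lborel. norm (e p x * (G p * f x))) = norm (G p) * (LINT x|lborel. norm (f x))" for p
      by (simp add: norm_mult e_def)
    then show "integrable lborel (\<lambda>p. LINT x|lborel. norm (case (p, x) of (p, x) \<Rightarrow> e p x * (G p * f x)))"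
      using G by (simp add: integrable_norm)
    have "integrable lborel (\<lambda>x. e p x * (G p * f x))" for p
      using f by (intro integrable_bounded_mult[where C = 1] integrable_mult_right) (auto simp: e_def)
    then show "AE p in lborel. integrable lborel (\<lambda>x. case (p, x) of (p, x) \<Rightarrow> e p x * (G p * f x))"
      by simp
  qed
  have "(LINT p|lborel. exp (- (\<i> * complex_of_real (p * y))) *
      (LINT x|lborel. exp (\<i> * complex_of_real (p * x)) * f x) * G p) =
    (LINT p|lborel. LINT x|lborel. e p x * (G p * f x))"
  proof (rule Bochner_Integration.integral_cong)
    fix p :: real
    have "exp (- (\<i> * complex_of_real (p * y))) * (exp (\<i> * complex_of_real (p * x)) * f x) * G p
        = e p x * (G p * f x)" for x
      unfolding e_def by (simp add: algebra_simps exp_diff exp_minus divide_inverse)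
    then show "exp (- (\<i> * complex_of_real (p * y))) *
        (LINT x|lborel. exp (\<i> * complex_of_real (p * x)) * f x) * G p =
        (LINT x|lborel. e p x * (G p * f x))"
      by (simp only: integral_mult_right_zero[symmetric] integral_mult_left_zero[symmetric])
  qed simp
  also have "\<dots> = (LINT x|lborel. LINT p|lborel. e p x * (G p * f x))"
    by (rule lborel_pair.Fubini_integral[OF int, symmetric])
  also have "\<dots> = (LINT x|lborel. complex_of_real (sqrt (2 * pi) / \<sigma> * exp (- ((x - y) / \<sigma>)\<^sup>2 / 2)) * f x)"
  proof (rule Bochner_Integration.integral_cong)
    fix x
    have "complex_of_real (sqrt (2 * pi) * exp (- ((x - y) / \<sigma>)\<^sup>2 / 2)) =
        (LINT s|lborel. exp (\<i> * complex_of_real (s * ((x - y) / \<sigma>))) * complex_of_real (exp (- s\<^sup>2 / 2)))"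
      by (rule integral_gaussian_character[symmetric])
    \<comment> \<open>Substitution \<open>s = \<sigma> * p\<close>.\<close>
    also have "\<dots> = \<bar>\<sigma>\<bar> *\<^sub>R (LINT p|lborel. e p x * G p)"
      using \<open>\<sigma> > 0\<close> by (subst lborel_integral_real_affine[of \<sigma> _ 0]) (auto simp: e_def G_def mult_ac)
    finally have "(LINT p|lborel. e p x * G p) = complex_of_real (sqrt (2 * pi) / \<sigma> * exp (- ((x - y) / \<sigma>)\<^sup>2 / 2))"
      using \<open>\<sigma> > 0\<close> by (simp add: scaleR_conv_of_real field_simps)
    then show "(LINT p|lborel. e p x * (G p * f x)) =
        complex_of_real (sqrt (2 * pi) / \<sigma> * exp (- ((x - y) / \<sigma>)\<^sup>2 / 2)) * f x"
      by (simp only: mult.assoc[symmetric] integral_mult_left_zero)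
  qed simp
  \<comment> \<open>Substitution \<open>x = y + \<sigma> * z\<close>; its Jacobian will cancel the
    factor \<open>1 / \<sigma>\<close>.\<close>
  also have "\<dots> = \<bar>\<sigma>\<bar> *\<^sub>R (LINT z|lborel. complex_of_real (sqrt (2 * pi) / \<sigma> * exp (- ((y + \<sigma> * z - y) / \<sigma>)\<^sup>2 / 2)) * f (y + \<sigma> * z))"
    using \<open>\<sigma> > 0\<close> by (intro lborel_integral_real_affine) auto
  also have "\<dots> = \<bar>\<sigma>\<bar> *\<^sub>R (LINT z|lborel. complex_of_real (sqrt (2 * pi) / \<sigma>) *
      (f (y + \<sigma> * z) * complex_of_real (exp (- z\<^sup>2 / 2))))"
    using \<open>\<sigma> > 0\<close> by (simp add: mult_ac)
  also have "\<dots> = complex_of_real (sqrt (2 * pi)) *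
      (LINT z|lborel. f (y + \<sigma> * z) * complex_of_real (exp (- z\<^sup>2 / 2)))"
    unfolding integral_mult_right_zero using \<open>\<sigma> > 0\<close> by (simp add: scaleR_conv_of_real)
  finally show ?thesis
    unfolding G_def .
qed

text \<open>Regularise by a Gaussian and let its parameter \<sigma> tend to 0. One side converges to
  the wanted integral, dominated by \<open>norm (F p)\<close>; by
  \<open>gaussian_mean_integral\<close> it also equals a Gaussian mean of \<open>f\<close> around
  \<open>y\<close>, which converges by continuity and boundedness of \<open>f\<close>.\<close>

theorem fourier_inversion:
  fixes f :: "real \<Rightarrow> complex" and y :: real
  defines "F \<equiv> \<lambda>p. LINT x|lborel. exp (\<i> * complex_of_real (p * x)) * f x"
  assumes f: "integrable lborel f" "continuous_on UNIV f" "bounded (range f)"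
    and F: "integrable lborel F"
  shows "(LINT p|lborel. exp (- (\<i> * complex_of_real (p * y))) * F p) = 2 * pi * f y"
proof -
  define \<sigma> where "\<sigma> n = 1 / real (Suc n)" for n
  have \<sigma>: "\<sigma> n > 0" "\<sigma> \<longlonglongrightarrow> 0" for n
    unfolding \<sigma>_def using LIMSEQ_inverse_real_of_nat by (auto simp: inverse_eq_divide)
  obtain C where C: "\<And>x. norm (f x) \<le> C"
    using f(3) by (auto simp: bounded_iff)
  have [measurable]: "f \<in> borel_measurable borel" "F \<in> borel_measurable borel"
    using f F by (auto simp: borel_measurable_integrable)
  have "(\<lambda>n. LINT p|lborel. exp (- (\<i> * complex_of_real (p * y))) * F p * complex_of_real (exp (- (\<sigma> n * p)\<^sup>2 / 2)))
      \<longlonglongrightarrow> (LINT p|lborel. exp (- (\<i> * complex_of_real (p * y))) * F p)"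
  proof (rule integral_dominated_convergence[where w = "\<lambda>p. norm (F p)"])
    show "AE p in lborel. (\<lambda>n. exp (- (\<i> * complex_of_real (p * y))) * F p * complex_of_real (exp (- (\<sigma> n * p)\<^sup>2 / 2)))
        \<longlonglongrightarrow> exp (- (\<i> * complex_of_real (p * y))) * F p"
    proof (rule AE_I2)
      fix p
      have "(\<lambda>n. exp (- (\<i> * complex_of_real (p * y))) * F p * complex_of_real (exp (- (\<sigma> n * p)\<^sup>2 / 2)))
        \<longlonglongrightarrow> exp (- (\<i> * complex_of_real (p * y))) * F p * complex_of_real (exp (- (0 * p)\<^sup>2 / 2))"
        by (intro tendsto_intros \<sigma>) auto
      then show "(\<lambda>n. exp (- (\<i> * complex_of_real (p * y))) * F p * complex_of_real (exp (- (\<sigma> n * p)\<^sup>2 / 2)))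
        \<longlonglongrightarrow> exp (- (\<i> * complex_of_real (p * y))) * F p" by simp
    qed
    show "AE p in lborel. norm (exp (- (\<i> * complex_of_real (p * y))) * F p * complex_of_real (exp (- (\<sigma> n * p)\<^sup>2 / 2)))
        \<le> norm (F p)" for n
      by (auto simp: norm_mult mult_left_le)
  qed (use F in auto)
  also have "(\<lambda>n. LINT p|lborel. exp (- (\<i> * complex_of_real (p * y))) * F p * complex_of_real (exp (- (\<sigma> n * p)\<^sup>2 / 2))) =
      (\<lambda>n. complex_of_real (sqrt (2 * pi)) *
        (LINT z|lborel. f (y + \<sigma> n * z) * complex_of_real (exp (- z\<^sup>2 / 2))))"
    unfolding F_def using gaussian_mean_integral[OF f(1) \<sigma>(1)] by blast
  finally have lim1: "\<dots> \<longlonglongrightarrow> (LINT p|lborel. exp (- (\<i> * complex_of_real (p * y))) * F p)" .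
  have "(\<lambda>n. LINT z|lborel. f (y + \<sigma> n * z) * complex_of_real (exp (- z\<^sup>2 / 2)))
      \<longlonglongrightarrow> (LINT z|lborel. f y * complex_of_real (exp (- z\<^sup>2 / 2)))"
  proof (rule integral_dominated_convergence[where w = "\<lambda>z. C * exp (- z\<^sup>2 / 2)"])
    show "integrable lborel (\<lambda>z. C * exp (- z\<^sup>2 / 2))"
      using integrable_gaussian[of 1] by simp
    show "AE z in lborel. (\<lambda>n. f (y + \<sigma> n * z) * complex_of_real (exp (- z\<^sup>2 / 2)))
        \<longlonglongrightarrow> f y * complex_of_real (exp (- z\<^sup>2 / 2))"
    proof (rule AE_I2)
      fix z
      have "(\<lambda>n. y + \<sigma> n * z) \<longlonglongrightarrow> y + 0 * z"
        by (intro tendsto_intros \<sigma>)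
      then have "(\<lambda>n. f (y + \<sigma> n * z)) \<longlonglongrightarrow> f y"
        using f(2) by (intro isCont_tendsto_compose[of y f]) (auto simp: continuous_on_eq_continuous_at)
      then show "(\<lambda>n. f (y + \<sigma> n * z) * complex_of_real (exp (- z\<^sup>2 / 2)))
          \<longlonglongrightarrow> f y * complex_of_real (exp (- z\<^sup>2 / 2))"
        by (intro tendsto_intros)
    qed
    show "AE z in lborel. norm (f (y + \<sigma> n * z) * complex_of_real (exp (- z\<^sup>2 / 2))) \<le> C * exp (- z\<^sup>2 / 2)" for n
      using C by (auto simp: norm_mult intro!: mult_right_mono)
  qed auto
  also have "(LINT z|lborel. f y * complex_of_real (exp (- z\<^sup>2 / 2))) = f y * complex_of_real (sqrt (2 * pi))"
    by (simp only: integral_mult_right_zero integral_gaussian)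
  finally have lim2: "(\<lambda>n. complex_of_real (sqrt (2 * pi)) *
        (LINT z|lborel. f (y + \<sigma> n * z) * complex_of_real (exp (- z\<^sup>2 / 2))))
      \<longlonglongrightarrow> complex_of_real (sqrt (2 * pi)) * (f y * complex_of_real (sqrt (2 * pi)))"
    by (rule tendsto_mult_left)
  \<comment> \<open>One root comes from transforming the Gaussian, the other is the total mass of
    the Gaussian weight.\<close>
  have "complex_of_real (sqrt (2 * pi)) * complex_of_real (sqrt (2 * pi)) = 2 * pi"
    by (simp flip: of_real_mult)
  then show ?thesis
    using LIMSEQ_unique[OF lim1 lim2] by (simp add: mult_ac)
qed

section \<open>The partial Fourier transform of a test function\<close>

lemma vector_2_add_axis:
  "vector [a, b] + t *\<^sub>R axis 1 1 = (vector [a + t, b] :: real ^ 2)"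
  "vector [a, b] + t *\<^sub>R axis 2 1 = (vector [a, b + t] :: real ^ 2)"
  by (simp_all add: vec_eq_iff forall_2 axis_component_2)

lemma smooth_has_vector_derivative_1:
  assumes "smooth f"
  shows "((\<lambda>t. f (vector [t, b])) has_vector_derivative partial 1 f (vector [a, b])) (at a)"
  using has_partial_along[OF smooth_has_partial[OF assms], where i = 1 and x = "vector [0, b]" and s = a]
  by (simp add: vector_2_add_axis)

lemma continuous_on_test_function [continuous_intros]:
  assumes "test_function u" "continuous_on S f" "continuous_on S g"
  shows "continuous_on S (\<lambda>x. u (vector [f x, g x]))"
  using assms
  by (intro continuous_on_compose2[OF smooth_imp_continuous continuous_on_vector_2])
     (auto simp: test_function_smooth)

lemma integrable_test_function:
  assumes "test_function u" "continuous_on UNIV h"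
  shows "integrable lborel (\<lambda>x. h x * u (vector [x, q]))"
proof -
  obtain R where "\<And>x q. \<bar>x\<bar> \<ge> R \<Longrightarrow> u (vector [x, q]) = 0"
    using test_function_vanishes[OF assms(1)] by blast
  then show ?thesis
    by (intro integrable_lborel_vanishing[of _ R] continuous_intros assms) simp
qed

lemma Fp_inv_eq_integral:
  assumes "test_function u" "\<And>x q. \<bar>x\<bar> \<ge> R \<Longrightarrow> u (vector [x, q]) = 0"
  shows "Fp_inv u y = 1 / sqrt (2 * pi) *
    integral (cbox (- R) R) (\<lambda>x. exp (\<i> * complex_of_real (y $ 1) * complex_of_real x) * u (vector [x, y $ 2]))"
  unfolding Fp_inv_def cbox_interval
  by (subst integral_lborel_vanishing[of _ R]) (auto intro!: continuous_intros assms)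

lemma has_vector_derivative_exp_mult:
  "((\<lambda>t. exp (c * complex_of_real (a + t))) has_vector_derivative
    c * exp (c * complex_of_real (a + t))) (at t)"
proof -
  have "((\<lambda>z. exp (c * (complex_of_real a + z))) has_field_derivative
      c * exp (c * (complex_of_real a + complex_of_real t))) (at (complex_of_real t))"
    by (auto intro!: derivative_eq_intros)
  from has_vector_derivative_real_field[OF this] show ?thesis
    by simp
qed

lemma continuous_on_Fp_inv:
  assumes "test_function u"
  shows "continuous_on UNIV (Fp_inv u)"
proof -
  obtain R where R: "\<And>x q. \<bar>x\<bar> \<ge> R \<Longrightarrow> u (vector [x, q]) = 0"
    using test_function_vanishes[OF assms] by blast
  have "Fp_inv u = (\<lambda>y. 1 / sqrt (2 * pi) * integral (cbox (- R) R)
      (\<lambda>x. exp (\<i> * complex_of_real (y $ 1) * complex_of_real x) * u (vector [x, y $ 2])))"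
    by (rule ext) (rule Fp_inv_eq_integral[OF assms R])
  then show ?thesis
    by (simp only:, intro continuous_on_mult_left integral_continuous_on_param;
       (auto simp: split_beta intro!: continuous_intros assms))
qed

section \<open>Differentiation and multiplication under the inverse transform\<close>

lemma test_function_component_mult:
  assumes "test_function u"
  shows "test_function (\<lambda>y. (\<i> * complex_of_real (y $ 1)) ^ n * u y)"
  by (intro test_function_mult assms smooth_power smooth_mult smooth_const smooth_component)

text \<open>The variable \<open>p\<close> enters only through the character, whose derivative brings
  down \<i> times the integration variable. Differentiation under the integral is over a fixed
  compact interval.\<close>

lemma has_partial_1_Fp_inv:
  assumes "test_function u"
  shows "has_partial 1 (Fp_inv u) (Fp_inv (\<lambda>y. \<i> * complex_of_real (y $ 1) * u y))"
  unfolding has_partial_def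
proof
  fix y :: "real ^ 2"
  obtain R where R: "\<And>x q. \<bar>x\<bar> \<ge> R \<Longrightarrow> u (vector [x, q]) = 0"
    using test_function_vanishes[OF assms] by blast
  have test: "test_function (\<lambda>y. \<i> * complex_of_real (y $ 1) * u y)"
    using test_function_component_mult[OF assms, of 1] by simp
  have "((\<lambda>t. exp (\<i> * complex_of_real (y $ 1 + t) * complex_of_real x) * u (vector [x, y $ 2]))
      has_vector_derivative exp (\<i> * complex_of_real (y $ 1 + t) * complex_of_real x) *
        (\<i> * complex_of_real x * u (vector [x, y $ 2]))) (at t)" for x t
    using has_vector_derivative_mult_left[OF has_vector_derivative_exp_mult[of "\<i> * complex_of_real x" "y $ 1" t],
        of "u (vector [x, y $ 2])"]
    by (simp only: mult_ac)
  then have "((\<lambda>t. integral (cbox (- R) R)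
        (\<lambda>x. exp (\<i> * complex_of_real (y $ 1 + t) * complex_of_real x) * u (vector [x, y $ 2])))
      has_vector_derivative integral (cbox (- R) R)
        (\<lambda>x. exp (\<i> * complex_of_real (y $ 1 + 0) * complex_of_real x) *
          (\<i> * complex_of_real x * u (vector [x, y $ 2])))) (at 0 within UNIV)"
    by (intro leibniz_rule_vector_derivative integrable_continuous)
       (auto simp: split_beta intro!: continuous_intros assms)
  from has_vector_derivative_mult_right[OF this, of "1 / sqrt (2 * pi)"]
  show "((\<lambda>t. Fp_inv u (y + t *\<^sub>R axis 1 1)) has_vector_derivative
      Fp_inv (\<lambda>y. \<i> * complex_of_real (y $ 1) * u y) y) (at 0)"
    using R by (simp add: Fp_inv_eq_integral[OF assms R] Fp_inv_eq_integral[OF test, of R]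
        axis_component_2)
qed

lemma has_partial_2_Fp_inv:
  assumes "test_function u"
  shows "has_partial 2 (Fp_inv u) (Fp_inv (partial 2 u))"
  unfolding has_partial_def
proof
  fix y :: "real ^ 2"
  obtain R where R: "\<And>x q. \<bar>x\<bar> \<ge> R \<Longrightarrow> u (vector [x, q]) = 0"
    using test_function_vanishes[OF assms] by blast
  \<comment> \<open>Here \<open>u\<close> vanishes on the whole vertical line, so the same radius
    serves the derivative in \<open>q\<close>.\<close>
  have R': "partial 2 u (vector [x, q]) = 0" if "\<bar>x\<bar> \<ge> R" for x q
    using R[OF that] by (simp add: partial_def vector_2_add_axis)
  have test: "test_function (partial 2 u)"
    by (rule test_function_partial[OF assms])
  have "((\<lambda>t. u (vector [x, y $ 2 + t])) has_vector_derivative partial 2 u (vector [x, y $ 2 + t])) (at t)"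
    for x t
    using has_partial_along[OF smooth_has_partial[OF test_function_smooth[OF assms]],
        where i = 2 and x = "vector [x, y $ 2]" and s = t]
    by (simp add: vector_2_add_axis)
  then have "((\<lambda>t. integral (cbox (- R) R)
        (\<lambda>x. exp (\<i> * complex_of_real (y $ 1) * complex_of_real x) * u (vector [x, y $ 2 + t])))
      has_vector_derivative integral (cbox (- R) R)
        (\<lambda>x. exp (\<i> * complex_of_real (y $ 1) * complex_of_real x) * partial 2 u (vector [x, y $ 2 + 0])))
      (at 0 within UNIV)"
    by (intro leibniz_rule_vector_derivative integrable_continuous)
       (auto simp: split_beta intro!: has_vector_derivative_mult_right continuous_intros assms test)
  from has_vector_derivative_mult_right[OF this, of "1 / sqrt (2 * pi)"]
  show "((\<lambda>t. Fp_inv u (y + t *\<^sub>R axis 2 1)) has_vector_derivative Fp_inv (partial 2 u) y) (at 0)"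
    by (simp add: Fp_inv_eq_integral[OF assms R] Fp_inv_eq_integral[OF test R'] axis_component_2)
qed

text \<open>The inverse transforms of test functions form a class suitable for
  \<open>smooth_coinduct\<close>: both partial derivatives are again inverse transforms of test
  functions.\<close>

lemma smooth_Fp_inv:
  assumes "test_function u"
  shows "smooth (Fp_inv u)"
proof (rule smooth_coinduct[of "\<lambda>f. \<exists>u. test_function u \<and> f = Fp_inv u"])
  show "\<exists>v. test_function v \<and> Fp_inv u = Fp_inv v"
    using assms by blast
  show "continuous_on UNIV f" if "\<exists>u. test_function u \<and> f = Fp_inv u" for f
    using that continuous_on_Fp_inv by blast
  fix f and i :: 2
  assume "\<exists>u. test_function u \<and> f = Fp_inv u"
  then obtain u where u: "test_function u" "f = Fp_inv u"
    by blast
  consider "i = 1" | "i = 2"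
    using exhaust_2[of i] by blast
  then show "\<exists>f'. has_partial i f f' \<and> (\<exists>u. test_function u \<and> f' = Fp_inv u)"
  proof cases
    case 1
    then show ?thesis
      using u has_partial_1_Fp_inv test_function_component_mult[OF u(1), of 1] by auto
  next
    case 2
    then show ?thesis
      using u has_partial_2_Fp_inv test_function_partial by blast
  qed
qed

lemma partials_1_Fp_inv:
  assumes "test_function u"
  shows "partials (replicate n 1) (Fp_inv u) = Fp_inv (\<lambda>y. (\<i> * complex_of_real (y $ 1)) ^ n * u y)"
proof (induction n)
  case 0
  then show ?case
    by (simp add: partials_def)
next
  case (Suc n)
  then have "partials (replicate (Suc n) 1) (Fp_inv u) =
      partial 1 (Fp_inv (\<lambda>y. (\<i> * complex_of_real (y $ 1)) ^ n * u y))"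
    by (simp add: partials_def)
  also have "\<dots> = Fp_inv (\<lambda>y. (\<i> * complex_of_real (y $ 1)) ^ Suc n * u y)"
    using partial_eqI[OF has_partial_1_Fp_inv[OF test_function_component_mult[OF assms]]]
    by (simp add: mult_ac)
  finally show ?case .
qed

text \<open>Integration by parts over an interval at whose ends \<open>u\<close> vanishes, so that
  no boundary terms remain.\<close>

lemma Fp_inv_partial_1:
  assumes "test_function u"
  shows "Fp_inv (partial 1 u) y = - (\<i> * complex_of_real (y $ 1)) * Fp_inv u y"
proof -
  obtain R where R: "R > 0" "\<And>x q. \<bar>x\<bar> \<ge> R \<Longrightarrow> u (vector [x, q]) = 0"
    using test_function_vanishes[OF assms] by blast
  define e where "e x = exp (\<i> * complex_of_real (y $ 1) * complex_of_real x)" for x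
  have e: "continuous_on UNIV e"
    unfolding e_def by (intro continuous_intros)
  have test: "test_function (partial 1 u)"
    by (rule test_function_partial[OF assms])
  obtain R' where R': "\<And>x q. \<bar>x\<bar> \<ge> R' \<Longrightarrow> partial 1 u (vector [x, q]) = 0"
    using test_function_vanishes[OF test] by blast
  \<comment> \<open>A common radius for \<open>u\<close> and its derivative, so that both transforms
    are integrals over one interval.\<close>
  define r where "r = max R R'"
  have r: "r > 0" "\<And>x q. \<bar>x\<bar> \<ge> r \<Longrightarrow> u (vector [x, q]) = 0"
    "\<And>x q. \<bar>x\<bar> \<ge> r \<Longrightarrow> partial 1 u (vector [x, q]) = 0"
    using R(1) by (auto simp: r_def intro: R(2) R')
  have der: "((\<lambda>x. e x * u (vector [x, y $ 2])) has_vector_derivative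
      \<i> * complex_of_real (y $ 1) * (e x * u (vector [x, y $ 2])) + e x * partial 1 u (vector [x, y $ 2])) (at x)" for x
  proof -
    have "(e has_vector_derivative \<i> * complex_of_real (y $ 1) * e x) (at x)"
      using has_vector_derivative_exp_mult[of "\<i> * complex_of_real (y $ 1)" 0 x]
      by (simp add: e_def[abs_def])
    from has_vector_derivative_mult[OF this smooth_has_vector_derivative_1[OF test_function_smooth[OF assms]]]
    show ?thesis
      by (simp add: algebra_simps)
  qed
  have "((\<lambda>x. \<i> * complex_of_real (y $ 1) * (e x * u (vector [x, y $ 2])) + e x * partial 1 u (vector [x, y $ 2]))
      has_integral e r * u (vector [r, y $ 2]) - e (- r) * u (vector [- r, y $ 2])) {- r..r}"
    using r(1) by (intro fundamental_theorem_of_calculus has_vector_derivative_at_within[OF der]) auto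
  then have "integral {- r..r} (\<lambda>x. \<i> * complex_of_real (y $ 1) * (e x * u (vector [x, y $ 2])) +
      e x * partial 1 u (vector [x, y $ 2])) = 0"
    using r by (simp add: integral_unique)
  moreover have "continuous_on {- r..r} e"
    using e continuous_on_subset by blast
  ultimately have "\<i> * complex_of_real (y $ 1) * integral {- r..r} (\<lambda>x. e x * u (vector [x, y $ 2])) +
      integral {- r..r} (\<lambda>x. e x * partial 1 u (vector [x, y $ 2])) = 0"
    by (subst (asm) integral_add)
       (auto intro!: integrable_continuous_interval continuous_intros assms test)
  then have "integral {- r..r} (\<lambda>x. e x * partial 1 u (vector [x, y $ 2])) =
      - (\<i> * complex_of_real (y $ 1)) * integral {- r..r} (\<lambda>x. e x * u (vector [x, y $ 2]))"
    by (simp add: eq_neg_iff_add_eq_0 add.commute)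
  then show ?thesis
    using Fp_inv_eq_integral[OF assms, of r y] Fp_inv_eq_integral[OF test, of r y] r
    by (simp add: e_def)
qed

section \<open>Linearity, decay and inversion of the partial transform\<close>

lemma Fp_inv_add:
  assumes "test_function u" "test_function v"
  shows "Fp_inv (\<lambda>y. u y + v y) y = Fp_inv u y + Fp_inv v y"
  unfolding Fp_inv_def distrib_left
  by (subst Bochner_Integration.integral_add)
     (auto intro!: integrable_test_function assms continuous_intros simp: distrib_left)

lemma Fp_inv_mult_2: "Fp_inv (\<lambda>y. h (y $ 2) * u y) y = h (y $ 2) * Fp_inv u y"
  unfolding Fp_inv_def by (simp add: mult.left_commute[of _ "h (y $ 2)"])

lemma Fp_inv_mult_const: "Fp_inv (\<lambda>y. c * u y) y = c * Fp_inv u y"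
  using Fp_inv_mult_2[of "\<lambda>_. c"] .

lemma Fp_inv_bounded:
  assumes "test_function u"
  shows "norm (Fp_inv u (vector [p, q])) \<le> 1 / sqrt (2 * pi) * (LINT x|lborel. norm (u (vector [x, q])))"
proof -
  have "norm (LINT x|lborel. exp (\<i> * complex_of_real p * complex_of_real x) * u (vector [x, q]))
      \<le> (LINT x|lborel. norm (exp (\<i> * complex_of_real p * complex_of_real x) * u (vector [x, q])))"
    by (rule integral_norm_bound)
  also have "\<dots> = (LINT x|lborel. norm (u (vector [x, q])))"
    by (simp add: norm_mult)
  finally show ?thesis
    by (simp add: Fp_inv_def norm_mult norm_divide divide_right_mono)
qed

text \<open>Two derivatives in \<open>x\<close> gain quadratic decay in \<open>p\<close>: the
  transform equals a bounded function divided by \<open>1 + p^2\<close>.\<close>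

lemma integrable_Fp_inv:
  assumes "test_function u"
  shows "integrable lborel (\<lambda>p. Fp_inv u (vector [p, q]))"
proof -
  \<comment> \<open>Each derivative in \<open>x\<close> becomes the factor
    \<open>- \<i> * p\<close>, so subtracting the second derivative becomes multiplication by
    \<open>1 + p^2\<close>, which has no real zero.\<close>
  define v where "v y = u y + - 1 * partial 1 (partial 1 u) y" for y
  have test: "test_function (partial 1 (partial 1 u))"
    by (intro test_function_partial assms)
  have test': "test_function (\<lambda>y. - 1 * partial 1 (partial 1 u) y)"
    by (intro test_function_mult test smooth_const)
  have v: "test_function v"
    unfolding v_def by (intro test_function_add assms test')
  have scale: "Fp_inv v (vector [p, q]) = complex_of_real (1 + p\<^sup>2) * Fp_inv u (vector [p, q])" for p
  proof -
    have "Fp_inv v (vector [p, q]) = Fp_inv u (vector [p, q]) + - 1 * Fp_inv (partial 1 (partial 1 u)) (vector [p, q])"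
      unfolding v_def[abs_def] by (subst Fp_inv_add[OF assms test']) (simp only: Fp_inv_mult_const)
    also have "\<dots> = complex_of_real (1 + p\<^sup>2) * Fp_inv u (vector [p, q])"
      by (simp add: Fp_inv_partial_1 assms test_function_partial power2_eq_square algebra_simps)
    finally show ?thesis .
  qed
  have eq: "Fp_inv u (vector [p, q]) = complex_of_real (1 / (1 + p\<^sup>2)) * Fp_inv v (vector [p, q])" for p
  proof -
    have "complex_of_real (1 + p\<^sup>2) \<noteq> 0"
      by (simp only: of_real_eq_0_iff) (metis sum_power2_eq_zero_iff one_neq_zero power_one)
    then show ?thesis
      unfolding scale of_real_divide of_real_1 times_divide_eq_left mult_1
      by (rule nonzero_mult_div_cancel_left[symmetric])
  qed
  have "continuous_on UNIV (\<lambda>p. Fp_inv v (vector [p, q]))"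
    by (rule continuous_on_compose2[OF continuous_on_Fp_inv[OF v] continuous_on_vector_2])
       (auto intro!: continuous_intros)
  then have "integrable lborel (\<lambda>p. Fp_inv v (vector [p, q]) * complex_of_real (1 / (1 + p\<^sup>2)))"
    using integrable_inverse_1_plus_square Fp_inv_bounded[OF v]
    by (intro integrable_bounded_mult integrable_of_real) (auto simp: set_integrable_def inverse_eq_divide
        intro: borel_measurable_continuous_onI)
  then show ?thesis
    by (subst eq) (simp add: mult.commute)
qed

text \<open>For fixed \<open>q\<close> this is \<open>fourier_inversion\<close> on a slice of
  \<open>u\<close>, which is continuous with compact support; integrability of its transform is
  \<open>integrable_Fp_inv\<close>. The two normalising factors cancel
  \<open>2 * pi\<close>.\<close>

lemma Fp_Fp_inv:
  assumes "test_function u"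
  shows "Fp (Fp_inv u) = u"
proof
  fix y :: "real ^ 2"
  define f where "f x = u (vector [x, y $ 2])" for x
  have F: "(LINT x|lborel. exp (\<i> * complex_of_real (p * x)) * f x) =
      sqrt (2 * pi) * Fp_inv u (vector [p, y $ 2])" for p
    by (simp add: Fp_inv_def f_def mult.assoc)
  obtain R where R: "\<And>x q. \<bar>x\<bar> \<ge> R \<Longrightarrow> u (vector [x, q]) = 0"
    using test_function_vanishes[OF assms] by blast
  have cont: "continuous_on UNIV f"
    unfolding f_def by (intro continuous_intros assms)
  have "bounded (f ` {- R..R})"
    by (intro compact_imp_bounded compact_continuous_image continuous_on_subset[OF cont]) auto
  moreover have "range f \<subseteq> insert 0 (f ` {- R..R})"
    using R by (force simp: f_def)
  ultimately have "bounded (range f)"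
    using bounded_subset bounded_insert by blast
  moreover have "integrable lborel f"
    unfolding f_def using integrable_test_function[OF assms, of "\<lambda>_. 1"] by simp
  moreover have "integrable lborel (\<lambda>p. LINT x|lborel. exp (\<i> * complex_of_real (p * x)) * f x)"
    unfolding F using integrable_Fp_inv[OF assms] by simp
  ultimately have "(LINT p|lborel. exp (- (\<i> * complex_of_real (p * y $ 1))) *
      (LINT x|lborel. exp (\<i> * complex_of_real (p * x)) * f x)) = 2 * pi * f (y $ 1)"
    using cont by (intro fourier_inversion)
  then have "sqrt (2 * pi) * (LINT p|lborel. exp (- (\<i> * complex_of_real p * complex_of_real (y $ 1))) *
      Fp_inv u (vector [p, y $ 2])) = 2 * pi * f (y $ 1)"
    unfolding F by (simp add: mult.left_commute[of _ "complex_of_real (sqrt _)"] mult.assoc)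
  also have "complex_of_real (2 * pi) * f (y $ 1) = sqrt (2 * pi) * (sqrt (2 * pi) * f (y $ 1))"
    by (simp only: mult.assoc[symmetric] of_real_mult[symmetric]) simp
  finally have "(LINT p|lborel. exp (- (\<i> * complex_of_real p * complex_of_real (y $ 1))) *
      Fp_inv u (vector [p, y $ 2])) = sqrt (2 * pi) * f (y $ 1)"
    by simp
  moreover have "vector [y $ 1, y $ 2] = y"
    by (simp add: vec_eq_iff forall_2)
  ultimately show "Fp (Fp_inv u) y = u y"
    by (simp add: Fp_def f_def)
qed

text \<open>As \<open>(\<i> / 2) * (\<i> * x) = - x / 2\<close>, the terms are the transforms of the
  exponential series of \<open>exp (- x / 2)\<close> times \<open>u\<close>. Compact support in
  \<open>x\<close> justifies exchanging sum and integral.\<close>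

lemma Fp_inv_exp_sums:
  assumes "test_function u"
  shows "(\<lambda>n. (\<i> / 2) ^ n / fact n * Fp_inv (\<lambda>y. (\<i> * complex_of_real (y $ 1)) ^ n * u y) y) sums
    Fp_inv (\<lambda>y. exp (- 1 / 2 * complex_of_real (y $ 1)) * u y) y"
proof -
  obtain R where R: "R > 0" "\<And>x q. \<bar>x\<bar> \<ge> R \<Longrightarrow> u (vector [x, q]) = 0"
    using test_function_vanishes[OF assms] by blast
  define w where "w x = exp (\<i> * complex_of_real (y $ 1) * complex_of_real x) * u (vector [x, y $ 2])" for x
  define f where "f n x = (- complex_of_real x / 2) ^ n / fact n * w x" for n x
  have w: "integrable lborel w"
    unfolding w_def by (intro integrable_test_function assms continuous_intros)
  have f: "integrable lborel (f n)" for n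
    unfolding f_def w_def mult.assoc[symmetric]
    by (intro integrable_test_function assms continuous_intros) auto
  \<comment> \<open>For \<open>x\<close> beyond \<open>R\<close> the factor \<open>w x\<close> is 0;
    elsewhere the power is bounded by that of \<open>R / 2\<close>. The majorant is summable in
    \<open>n\<close> and integrable in \<open>x\<close>.\<close>
  have norm: "norm (f n x) \<le> (R / 2) ^ n / fact n * norm (w x)" for n x
  proof (cases "\<bar>x\<bar> \<ge> R")
    case True
    then show ?thesis
      by (simp add: f_def w_def R)
  next
    case False
    then show ?thesis
      by (auto simp: f_def norm_mult norm_divide norm_power intro!: mult_right_mono divide_right_mono power_mono)
  qed
  have exp_summable: "summable (\<lambda>n. (R / 2) ^ n / fact n)"
    using summable_exp[of "R / 2"] by (simp only: divide_inverse mult.commute)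
  have sums: "(\<lambda>n. LINT x|lborel. f n x) sums (LINT x|lborel. (\<Sum>n. f n x))"
  proof (rule sums_integral)
    show "AE x in lborel. summable (\<lambda>n. norm (f n x))"
      using norm by (intro AE_I2 summable_comparison_test'[OF summable_mult2[OF exp_summable]]) auto
    have "(LINT x|lborel. norm (f n x)) \<le> (R / 2) ^ n / fact n * (LINT x|lborel. norm (w x))" for n
      using norm f w by (subst integral_mult_right_zero[symmetric], intro integral_mono) auto
    then show "summable (\<lambda>n. LINT x|lborel. norm (f n x))"
      by (intro summable_comparison_test'[OF summable_mult2[OF exp_summable]]) auto
  qed (rule f)
  have "(\<Sum>n. f n x) = exp (- complex_of_real x / 2) * w x" for x
  proof -
    have "(\<lambda>n. (- complex_of_real x / 2) ^ n / fact n) sums exp (- complex_of_real x / 2)"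
      using exp_converges[of "- complex_of_real x / 2"]
      by (simp only: scaleR_conv_of_real of_real_inverse of_real_fact divide_inverse mult.commute)
    from sums_mult2[OF this, of "w x"] show ?thesis
      unfolding f_def by (rule sums_unique[symmetric])
  qed
  with sums have "(\<lambda>n. 1 / sqrt (2 * pi) * (LINT x|lborel. f n x)) sums
      (1 / sqrt (2 * pi) * (LINT x|lborel. exp (- complex_of_real x / 2) * w x))"
    by (intro sums_mult) simp
  moreover have "1 / sqrt (2 * pi) * (LINT x|lborel. f n x) =
      (\<i> / 2) ^ n / fact n * Fp_inv (\<lambda>y. (\<i> * complex_of_real (y $ 1)) ^ n * u y) y" for n
  proof -
    have "f n x = (\<i> / 2) ^ n / fact n * (exp (\<i> * complex_of_real (y $ 1) * complex_of_real x) *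
        ((\<i> * complex_of_real x) ^ n * u (vector [x, y $ 2])))" for x
    proof -
      have "(- complex_of_real x / 2) ^ n = (\<i> / 2) ^ n * (\<i> * complex_of_real x) ^ n"
        by (simp flip: power_mult_distrib)
      then show ?thesis
        by (simp only: f_def w_def times_divide_eq_left times_divide_eq_right mult_ac)
    qed
    then show ?thesis
      unfolding Fp_inv_def vector_2 by (simp only: integral_mult_right_zero) (rule mult.left_commute)
  qed
  moreover have "1 / sqrt (2 * pi) * (LINT x|lborel. exp (- complex_of_real x / 2) * w x) =
      Fp_inv (\<lambda>y. exp (- 1 / 2 * complex_of_real (y $ 1)) * u y) y"
    by (simp add: Fp_inv_def w_def mult_ac)
  ultimately show ?thesis
    by simp
qed

section \<open>The Moyal series\<close>

lemma has_partial_i_tilde: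
  "has_partial i (i_tilde (aff_matrix \<alpha> \<beta>))
    (\<lambda>y. if i = 1 then \<i> * complex_of_real \<alpha> else \<i> * complex_of_real \<beta> * exp (complex_of_real (y $ 2)))"
proof -
  have *: "i_tilde (aff_matrix \<alpha> \<beta>) =
      (\<lambda>y. \<i> * complex_of_real \<alpha> * complex_of_real (y $ 1) + \<i> * complex_of_real \<beta> * exp (complex_of_real (y $ 2)))"
    by (simp add: i_tilde_def tilde_aff_matrix fun_eq_iff algebra_simps exp_of_real)
  have "has_partial i (i_tilde (aff_matrix \<alpha> \<beta>))
      (\<lambda>y. of_bool (i = 1) * (\<i> * complex_of_real \<alpha>) +
        of_bool (i = 2) * (\<i> * complex_of_real \<beta> * exp (complex_of_real (y $ 2))))"
    unfolding * by (intro has_partial_add has_partial_comp_2) (auto intro!: derivative_eq_intros)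
  moreover have "(\<lambda>y :: real ^ 2. of_bool (i = 1) * (\<i> * complex_of_real \<alpha>) +
        of_bool (i = 2) * (\<i> * complex_of_real \<beta> * exp (complex_of_real (y $ 2)))) =
      (\<lambda>y. if i = 1 then \<i> * complex_of_real \<alpha> else \<i> * complex_of_real \<beta> * exp (complex_of_real (y $ 2)))"
    using exhaust_2[of i] by auto
  ultimately show ?thesis
    by simp
qed

text \<open>The term linear in \<open>p\<close> survives at most one derivative, in direction 1, and
  the exponential in \<open>q\<close> is killed by any such derivative but reproduced by direction
  2. The list \<open>[1]\<close> is tested before membership of 1 because there the constant
  remains.\<close>

lemma partials_i_tilde:
  "partials is (i_tilde (aff_matrix \<alpha> \<beta>)) =
    (if is = [] then i_tilde (aff_matrix \<alpha> \<beta>)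
     else if is = [1] then (\<lambda>_. \<i> * complex_of_real \<alpha>)
     else if 1 \<in> set is then (\<lambda>_. 0)
     else (\<lambda>y. \<i> * complex_of_real \<beta> * exp (complex_of_real (y $ 2))))"
proof (induction "is")
  case Nil
  then show ?case
    by (simp add: partials_def)
next
  case (Cons i "is")
  let ?e = "\<lambda>y :: real ^ 2. \<i> * complex_of_real \<beta> * exp (complex_of_real (y $ 2))"
  have "has_partial j ?e (\<lambda>y. of_bool (j = 2) * ?e y)" for j
    by (rule has_partial_comp_2) (auto intro!: derivative_eq_intros)
  from partial_eqI[OF this] have e: "partial j ?e = (if j = 1 then (\<lambda>_. 0) else ?e)" for j
    using exhaust_2[of j] by auto
  have const: "partial j (\<lambda>_. c) = (\<lambda>_. 0)" for c j
    by (rule partial_eqI[OF has_partial_const])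
  have "partials (i # is) (i_tilde (aff_matrix \<alpha> \<beta>)) = partial i (partials is (i_tilde (aff_matrix \<alpha> \<beta>)))"
    by (simp add: partials_def)
  then show ?case
    unfolding Cons.IH using partial_eqI[OF has_partial_i_tilde[of i \<alpha> \<beta>]] by (auto simp: e const)
qed

lemma finite_lists_length: "finite {xs :: 'a :: finite list. length xs = n}"
  using finite_lists_length_eq[of "UNIV :: 'a set" n] by simp

text \<open>The Poisson bracket, the only order at which \<alpha> enters \<open>moyal_P\<close>
  through a derivative of the symbol.\<close>

lemma moyal_P_i_tilde_1:
  "moyal_P 1 (i_tilde (aff_matrix \<alpha> \<beta>)) v y =
    \<i> * complex_of_real \<alpha> * partial 2 v y
    - \<i> * complex_of_real \<beta> * exp (complex_of_real (y $ 2)) * partial 1 v y"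
proof -
  have lists: "{ks :: (2 \<times> 2) list. length ks = 1} = (\<lambda>k. [k]) ` (UNIV \<times> UNIV)"
    by (auto simp: length_Suc_conv)
  show ?thesis
    unfolding moyal_P_def lists
    by (subst sum.reindex) (simp_all add: inj_on_def sum.cartesian_product' [symmetric] UNIV_2 Lambda_def
        partials_i_tilde, simp add: partials_def)
qed

text \<open>From order two on, only the derivatives \<open>\<partial>\<^sub>q\<^sup>n\<close> of \<open>\<alpha> p + \<beta> e\<^sup>q\<close> survive, and \<^const>\<open>Lambda\<close> pairs
  each \<open>\<partial>\<^sub>q\<close> with a \<open>\<partial>\<^sub>p\<close>.\<close>

lemma moyal_P_i_tilde:
  assumes "n \<ge> 2"
  shows "moyal_P n (i_tilde (aff_matrix \<alpha> \<beta>)) v y =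
    (- 1) ^ n * (\<i> * complex_of_real \<beta> * exp (complex_of_real (y $ 2))) * partials (replicate n 1) v y"
proof -
  let ?a = "i_tilde (aff_matrix \<alpha> \<beta>)"
  let ?g = "\<lambda>ks. (\<Prod>(i, j)\<leftarrow>ks. Lambda i j) * partials (map fst ks) ?a y * partials (map snd ks) v y"
  have zero: "?g ks = 0" if ks: "length ks = n" "ks \<noteq> replicate n (2, 1)" for ks
  proof -
    obtain i j where ij: "(i, j) \<in> set ks" "(i, j) \<noteq> (2, 1)"
      using ks replicate_eqI[of ks n "(2, 1)"] by auto
    show ?thesis
    proof (cases "Lambda i j = 0")
      case True
      then have "(\<Prod>(i, j)\<leftarrow>ks. Lambda i j) = 0"
        using ij by (force simp: prod_list_zero_iff)
      then show ?thesis
        by simp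
    next
      case False
      \<comment> \<open>The only remaining pair is \<open>(1, 2)\<close>: it differentiates the
        symbol in \<open>p\<close>, which gives 0 within a list of length at least 2.\<close>
      then have "i = 1"
        using ij by (auto simp: Lambda_def split: if_splits)
      then have "1 \<in> set (map fst ks)"
        using ij by force
      moreover have "map fst ks \<noteq> [1]" "map fst ks \<noteq> []"
        using arg_cong[of "map fst ks" _ length] ks assms by force+
      ultimately show ?thesis
        by (simp add: partials_i_tilde)
    qed
  qed
  have "moyal_P n ?a v y = sum ?g {replicate n (2, 1)}"
    unfolding moyal_P_def
    by (rule sum.mono_neutral_right) (use zero finite_lists_length in auto)
  moreover have "replicate n (2 :: 2) \<noteq> [1]" "replicate n (2 :: 2) \<noteq> []"
    using assms by (auto dest: arg_cong[where f = length])
  \<comment> \<open>Each pair \<open>(2, 1)\<close> contributes the sign -1.\<close>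
  ultimately show ?thesis
    by (simp add: partials_i_tilde prod_list_replicate Lambda_def)
qed

text \<open>The sign of \<open>Lambda 2 1\<close> turns \<open>1 / (2 * \<i>)\<close> into
  \<open>\<i> / 2\<close>, so the \<beta> part has one shape at all positive orders; the \<alpha>
  part occurs only at order one, which is \<open>n = 0\<close>.\<close>

lemma moyal_term_i_tilde:
  "moyal_term (i_tilde (aff_matrix \<alpha> \<beta>)) v y (Suc n) =
    \<i> * complex_of_real \<beta> * exp (complex_of_real (y $ 2)) *
      ((\<i> / 2) ^ Suc n / fact (Suc n) * partials (replicate (Suc n) 1) v y)
    + (if n = 0 then complex_of_real \<alpha> / 2 * partial 2 v y else 0)"
proof (cases "n = 0")
  case True
  have "moyal_term (i_tilde (aff_matrix \<alpha> \<beta>)) v y (Suc 0) =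
      1 / (2 * \<i>) * moyal_P 1 (i_tilde (aff_matrix \<alpha> \<beta>)) v y"
    by (simp add: moyal_term_def)
  also have "1 / (2 * \<i>) = - \<i> / 2"
    by (simp add: field_simps)
  finally show ?thesis
    using True by (simp add: moyal_P_i_tilde_1[unfolded One_nat_def] partials_def algebra_simps)
next
  case False
  have "1 / (2 * \<i>) * - 1 = \<i> / 2"
    by (simp add: field_simps)
  then have pow: "(1 / (2 * \<i>)) ^ Suc n * (- 1) ^ Suc n = (\<i> / 2) ^ Suc n"
    by (simp only: power_mult_distrib[symmetric])
  have arrange: "1 / c * a * (b * d * e) = d * (a * b / c * e)" for a b c d e :: complex
    by (simp add: divide_inverse mult_ac)
  have "Suc n \<ge> 2"
    using False by simp
  show ?thesis
    unfolding moyal_term_def moyal_P_i_tilde[OF \<open>Suc n \<ge> 2\<close>] arrange pow using False by simp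
qed

lemma moyal_i_tilde_sums:
  assumes "test_function u"
  defines "w \<equiv> Fp_inv u"
  shows "(\<lambda>n. moyal_term (i_tilde (aff_matrix \<alpha> \<beta>)) w y (Suc n)) sums
    (\<i> * complex_of_real \<beta> * exp (complex_of_real (y $ 2)) *
      (Fp_inv (\<lambda>y. exp (- 1 / 2 * complex_of_real (y $ 1)) * u y) y - w y)
      + complex_of_real \<alpha> / 2 * partial 2 w y)"
proof -
  let ?E = "\<lambda>n. (\<i> / 2) ^ n / fact n * partials (replicate n 1) w y"
  have "?E sums Fp_inv (\<lambda>y. exp (- 1 / 2 * complex_of_real (y $ 1)) * u y) y"
    unfolding w_def partials_1_Fp_inv[OF assms(1)] by (rule Fp_inv_exp_sums[OF assms(1)])
  \<comment> \<open>The Moyal series starts at order one, so the order-zero term \<open>w y\<close>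
    is subtracted from the exponential series.\<close>
  then have "(\<lambda>n. ?E (Suc n)) sums (Fp_inv (\<lambda>y. exp (- 1 / 2 * complex_of_real (y $ 1)) * u y) y - w y)"
    by (subst sums_Suc_iff) (simp add: partials_def)
  from sums_add[OF sums_mult[OF this] sums_single[of 0 "\<lambda>_. complex_of_real \<alpha> / 2 * partial 2 w y"]]
  show ?thesis
    unfolding moyal_term_i_tilde by simp
qed

section \<open>The transformed multiplication operator\<close>

lemma
  fixes \<alpha> \<beta> :: real
  assumes "test_function u"
  defines "g \<equiv> \<lambda>y. complex_of_real \<alpha> * (1 / 2 * partial 2 u y - partial 1 u y)
         + \<i> * complex_of_real \<beta> * complex_of_real (exp (y $ 2 - y $ 1 / 2)) * u y"
  shows test_function_ell_hat: "test_function g"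
    and ell_Fp_inv: "ell (aff_matrix \<alpha> \<beta>) (Fp_inv u) = Fp_inv g"
proof -
  \<comment> \<open>The pieces match the parts of the star product: \<open>g1\<close> is the
    first-order \<alpha> term, \<open>g2\<close> the pointwise product with the part linear in
    \<open>p\<close>, and \<open>g3\<close> the whole exponential series with its order-zero
    term.\<close>
  define g1 where "g1 y = complex_of_real \<alpha> / 2 * partial 2 u y" for y
  define g2 where "g2 y = - complex_of_real \<alpha> * partial 1 u y" for y
  \<comment> \<open>Kept apart from \<open>g3\<close>: the factor in \<open>q\<close> can be pulled
    out of the transform, the one in \<open>x\<close> cannot.\<close>
  define d where "d y = exp (- 1 / 2 * complex_of_real (y $ 1)) * u y" for y
  define g3 where "g3 y = \<i> * complex_of_real \<beta> * exp (complex_of_real (y $ 2)) * d y" for y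
  have g: "g = (\<lambda>y. g1 y + (g2 y + g3 y))"
  proof
    fix y :: "real ^ 2"
    have "complex_of_real (exp (y $ 2 - y $ 1 / 2)) =
        exp (complex_of_real (y $ 2)) * exp (- 1 / 2 * complex_of_real (y $ 1))"
      unfolding exp_of_real[symmetric] exp_add[symmetric] by simp
    then show "g y = g1 y + (g2 y + g3 y)"
      by (simp add: g_def g1_def g2_def g3_def d_def algebra_simps)
  qed
  have g1: "test_function g1" and g2: "test_function g2"
    unfolding g1_def g2_def by (intro test_function_mult test_function_partial assms smooth_const)+
  have d: "test_function d"
    unfolding d_def by (intro test_function_mult assms smooth_exp_component)
  have g3: "test_function g3"
    unfolding g3_def using smooth_exp_component[of 1 2]
    by (intro test_function_mult d smooth_mult smooth_const) simp
  show "test_function g"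
    unfolding g by (intro test_function_add g1 g2 g3)
  show "ell (aff_matrix \<alpha> \<beta>) (Fp_inv u) = Fp_inv g"
  proof
    fix y :: "real ^ 2"
    have "Fp_inv g y = Fp_inv g1 y + (Fp_inv g2 y + Fp_inv g3 y)"
      unfolding g by (simp only: Fp_inv_add g1 g2 g3 test_function_add)
    also have "Fp_inv g1 y = complex_of_real \<alpha> / 2 * partial 2 (Fp_inv u) y"
      unfolding g1_def Fp_inv_mult_const partial_eqI[OF has_partial_2_Fp_inv[OF assms(1)]] ..
    also have "Fp_inv g2 y = \<i> * complex_of_real \<alpha> * complex_of_real (y $ 1) * Fp_inv u y"
      unfolding g2_def Fp_inv_mult_const Fp_inv_partial_1[OF assms(1)] by simp
    also have "Fp_inv g3 y = \<i> * complex_of_real \<beta> * exp (complex_of_real (y $ 2)) * Fp_inv d y"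
      unfolding g3_def by (rule Fp_inv_mult_2)
    finally show "ell (aff_matrix \<alpha> \<beta>) (Fp_inv u) y = Fp_inv g y"
      \<comment> \<open>The subtracted \<open>Fp_inv u y\<close> cancels against the \<beta> part of
        the pointwise product.\<close>
      using sums_unique[OF moyal_i_tilde_sums[OF assms(1), of \<alpha> \<beta> y]]
      by (simp add: ell_def moyal_def i_tilde_def tilde_aff_matrix d_def[abs_def] algebra_simps exp_of_real)
  qed
qed

theorem proposition3p4:
  fixes \<alpha> \<beta> :: real and u :: "real ^ 2 \<Rightarrow> complex"
  assumes "test_function u"
  shows "smooth (Fp_inv u) \<and>
    (\<forall>y. summable (\<lambda>r. moyal_term (i_tilde (aff_matrix \<alpha> \<beta>)) (Fp_inv u) y (Suc r))) \<and>
    (\<forall>q. integrable lborel (\<lambda>p. ell (aff_matrix \<alpha> \<beta>) (Fp_inv u) (vector [p, q]))) \<and>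
    ell_hat (aff_matrix \<alpha> \<beta>) u =
      (\<lambda>y. complex_of_real \<alpha> * (1 / 2 * partial 2 u y - partial 1 u y)
         + \<i> * complex_of_real \<beta> * complex_of_real (exp (y $ 2 - y $ 1 / 2)) * u y)"
  \<comment> \<open>Since \<open>ell\<close> yields the inverse transform of a test function, its
    slices are integrable and the outer \<open>Fp\<close> is inverted by
    \<open>Fp_Fp_inv\<close>.\<close>
  using smooth_Fp_inv[OF assms] sums_summable[OF moyal_i_tilde_sums[OF assms]]
    integrable_Fp_inv[OF test_function_ell_hat[OF assms]] Fp_Fp_inv[OF test_function_ell_hat[OF assms]]
  by (simp add: ell_Fp_inv[OF assms] ell_hat_def)

end
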